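(* Let $F$ be a PCA with alphabet $\mathcal A=\{0,1\}$, neighborhood $\{0,1\}$ and parameters $\theta_{00},\theta_{01},\theta_{10},\theta_{11}\in[0,1]$ such that $$(\theta_{00},\theta_{01})\notin\{(0,0),(1,1)\}\quad\text{and}\quad(\theta_{10},\theta_{11})\notin\{(0,0),(1,1)\}.$$ Let $p\in(0,1)$. For $\alpha\in\{0,1\}$ and $q\in[0,1]$ set $$g_\alpha(q)=(1-q)(1-p)\theta_{00}^\alpha+(1-q)p\,\theta_{01}^\alpha+q(1-p)\theta_{10}^\alpha+qp\,\theta_{11}^\alpha,\qquad h_\alpha(q)=\frac{(1-q)p\,\theta_{01}^\alpha+qp\,\theta_{11}^\alpha}{g_\alpha(q)}.$$ Then for every $n\ge1$ and every word $\alpha_0\cdots\alpha_{n-1}\in\mathcal A^n$, the probability of the cylinder $[\alpha_0\cdots\alpha_{n-1}]$ under $\mu_pF$ is $$\mu_pF[\alpha_0\cdots\alpha_{n-1}]=g_{\alpha_0}(p)\prod_{i=1}^{n-1}g_{\alpha_i}\bigl(h_{\alpha_{i-1}}(h_{\alpha_{i-2}}(\cdots h_{\alpha_0}(p)\cdots))\bigr).$$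
   Context: A PCA with alphabet $\{0,1\}$ and neighborhood $\{0,1\}$ is determined by four parameters $\theta_{xy}\in[0,1]$, $x,y\in\{0,1\}$: the new value of cell $k$ equals $1$ with probability $\theta_{xy}$ when the current values of cells $k$ and $k+1$ are $x$ and $y$, independently for different cells. Notation: $\theta^1_{xy}=\theta_{xy}$ and $\theta^0_{xy}=1-\theta_{xy}$ (superscripts are indices, not powers). For a probability measure $\mu$ on $\{0,1\}^{\mathbb Z}$, $\mu F$ is the law of the configuration $Y$ obtained by applying one step of the PCA to $X\sim\mu$; explicitly $\mu F[y_a\cdots y_b]=\sum_{x_a\cdots x_{b+1}}\mu[x_a\cdots x_{b+1}]\prod_{k=a}^b\theta_{x_kx_{k+1}}^{y_k}$ for cylinders on consecutive cells, where $[y_a\cdots y_b]$ is the set of configurations whose entries at cells $a,\ldots,b$ are $y_a,\ldots,y_b$. $\mu_p$ denotes the Bernoulli product measure on $\{0,1\}^{\mathbb Z}$ in which each coordinate equals $1$ with probability $p$. Under the hypothesis on the parameters, $g_\alpha(q)\in(0,1)$ for all $q\in[0,1]$, so $h_\alpha$ is well defined with values in $[0,1]$. (Cylinders may be placed at any consecutive cells, by translation invariance.) *)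

theory Defs
  imports "HOL-Probability.Probability"
begin

(* The symbols 0 and 1 of the alphabet are False and True. *)

abbreviation config_space :: "(int \<Rightarrow> bool) measure" where
  "config_space \<equiv> \<Pi>\<^sub>M k\<in>UNIV. count_space UNIV"

definition bernoulli_product :: "real \<Rightarrow> (int \<Rightarrow> bool) measure" where
  "bernoulli_product p = (\<Pi>\<^sub>M k\<in>UNIV. measure_pmf (bernoulli_pmf p))"

(* Law of the updated configuration given the current configuration x; theta x y is the
   probability that a cell becomes 1 when it holds x and its right neighbour holds y.
   Note that bernoulli_pmf clamps its argument to the unit interval, so theta is meant to
   have values there. *)
definition pca_kernel :: "(bool \<Rightarrow> bool \<Rightarrow> real) \<Rightarrow> (int \<Rightarrow> bool) \<Rightarrow> (int \<Rightarrow> bool) measure" where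
  "pca_kernel \<theta> x = (\<Pi>\<^sub>M k\<in>UNIV. measure_pmf (bernoulli_pmf (\<theta> (x k) (x (k + 1)))))"

definition pca_step :: "(bool \<Rightarrow> bool \<Rightarrow> real) \<Rightarrow> (int \<Rightarrow> bool) measure \<Rightarrow> (int \<Rightarrow> bool) measure" where
  "pca_step \<theta> \<mu> = \<mu> \<bind> pca_kernel \<theta>"

(* The configurations carrying the word w on the cells m, ..., m + length w - 1. *)
definition cylinder :: "int \<Rightarrow> bool list \<Rightarrow> (int \<Rightarrow> bool) set" where
  "cylinder m w = {y. \<forall>i<length w. y (m + int i) = w ! i}"

definition trans_prob :: "(bool \<Rightarrow> bool \<Rightarrow> real) \<Rightarrow> bool \<Rightarrow> bool \<Rightarrow> bool \<Rightarrow> real" where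
  "trans_prob \<theta> \<alpha> x y = (if \<alpha> then \<theta> x y else 1 - \<theta> x y)"

definition g_fun :: "(bool \<Rightarrow> bool \<Rightarrow> real) \<Rightarrow> real \<Rightarrow> bool \<Rightarrow> real \<Rightarrow> real" where
  "g_fun \<theta> p \<alpha> q =
     (1 - q) * (1 - p) * trans_prob \<theta> \<alpha> False False + (1 - q) * p * trans_prob \<theta> \<alpha> False True
     + q * (1 - p) * trans_prob \<theta> \<alpha> True False + q * p * trans_prob \<theta> \<alpha> True True"

(* Composing along a word v: fold (h_fun theta p) v p = h_(last v) (... (h_(hd v) p)). *)
definition h_fun :: "(bool \<Rightarrow> bool \<Rightarrow> real) \<Rightarrow> real \<Rightarrow> bool \<Rightarrow> real \<Rightarrow> real" where
  "h_fun \<theta> p \<alpha> q =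
     ((1 - q) * p * trans_prob \<theta> \<alpha> False True + q * p * trans_prob \<theta> \<alpha> True True) / g_fun \<theta> p \<alpha> q"

(* This makes the monadic bind in pca_step the law of the updated configuration; bind is
   meaningless for a nonmeasurable kernel. *)
lemma measurable_pca_kernel: "pca_kernel \<theta> \<in> measurable config_space (prob_algebra config_space)"
proof (rule measurable_prob_algebra_generated[OF sets_PiM Int_stable_prod_algebra prod_algebra_sets_into_space])
  fix x :: "int \<Rightarrow> bool"
  show "prob_space (pca_kernel \<theta> x)"
    unfolding pca_kernel_def by (intro prob_space_PiM prob_space_measure_pmf)
  show "sets (pca_kernel \<theta> x) = sets config_space"
    unfolding pca_kernel_def by (intro sets_PiM_cong) auto
next
  fix A assume "A \<in> prod_algebra UNIV (\<lambda>k::int. count_space (UNIV :: bool set))"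
  then obtain J X where A: "A = prod_emb UNIV (\<lambda>_. count_space UNIV) J (Pi\<^sub>E J X)" "finite J"
    by (elim prod_algebraE) auto
  have "emeasure (pca_kernel \<theta> x) A
      = (\<Prod>k\<in>J. emeasure (measure_pmf (bernoulli_pmf (\<theta> (x k) (x (k + 1))))) (X k))" for x
  proof -
    interpret product_prob_space "\<lambda>k::int. measure_pmf (bernoulli_pmf (\<theta> (x k) (x (k + 1))))" UNIV
      by unfold_locales
    have "A = prod_emb UNIV (\<lambda>k. measure_pmf (bernoulli_pmf (\<theta> (x k) (x (k + 1))))) J (Pi\<^sub>E J X)"
      by (simp add: A prod_emb_def)
    then show ?thesis
      using A(2) emeasure_PiM_emb[of J X] by (simp add: pca_kernel_def)
  qed
  moreover have "(\<lambda>x. emeasure (measure_pmf (bernoulli_pmf (\<theta> (x k) (x (k + 1))))) (X k))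
      \<in> borel_measurable config_space" for k
    by (rule measurable_compose[where g = "\<lambda>(a, b). emeasure (measure_pmf (bernoulli_pmf (\<theta> a b))) (X k)"
          and f = "\<lambda>x. (x k, x (k + 1))" and N = "count_space UNIV \<Otimes>\<^sub>M count_space UNIV", simplified])
       (auto simp: pair_measure_countable)
  ultimately show "(\<lambda>x. emeasure (pca_kernel \<theta> x) A) \<in> borel_measurable config_space"
    by simp
qed

end

theory Submission
  imports Defs
begin

text \<open>
  Reveal the cells of the initial configuration from left to right. Suppose that, given the letters
  already observed in the image, the current cell holds 1 with probability \<open>q\<close>. The next cell is
  independent of this and holds 1 with probability \<open>p\<close>, so \<open>g_fun \<theta> p \<alpha> q\<close> is the probability
  that the next observed letter is \<open>\<alpha>\<close>, and by Bayes' rule \<open>h_fun \<theta> p \<alpha> q\<close> is the probability that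
  the right one of the two cells holds 1 once \<open>\<alpha>\<close> has been observed. After this update the
  situation is the same as before, one cell further to the right and with \<open>q\<close> replaced by
  \<open>h_fun \<theta> p \<alpha> q\<close>; the formula is the chain rule for the successive letters.

  Measure theory enters only through cylinders: both the Bernoulli measure and the kernel are product measures
  (\<open>measure_PiM_cylinder\<close>), and a word of length \<open>n\<close> in the image is decided by the
  \<open>n + 1\<close> cells above it. This turns the probability into a finite sum over words
  (\<open>measure_pca_step_cylinder\<close>), in which the leftmost cell is then summed out one letter at a time
  (\<open>sum_over_source_words\<close>), using Bayes' rule in the form of \<open>bayes_rule_next_cell\<close>.
\<close>

lemma sets_PiM_pmf:
  "sets (\<Pi>\<^sub>M k\<in>UNIV. measure_pmf (P k)) = sets config_space"
  by (intro sets_PiM_cong) auto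

lemma cylinder_eq_prod_emb:
  "cylinder m w = prod_emb UNIV M ((\<lambda>i. m + int i) ` {..<length w})
     (\<Pi>\<^sub>E k\<in>(\<lambda>i. m + int i) ` {..<length w}. {w ! nat (k - m)})"
  if "\<And>k. space (M k) = UNIV"
  using that by (auto simp: cylinder_def prod_emb_def space_PiM PiE_iff)

lemma cylinder_in_sets: "cylinder m w \<in> sets config_space"
  by (subst cylinder_eq_prod_emb[of "\<lambda>_. count_space UNIV"]) (auto intro!: sets_PiM_I)

lemma measure_PiM_cylinder:
  "measure (\<Pi>\<^sub>M k\<in>UNIV. measure_pmf (P k)) (cylinder m w) = (\<Prod>i<length w. pmf (P (m + int i)) (w ! i))"
proof -
  interpret product_prob_space "\<lambda>k::int. measure_pmf (P k)" UNIV
    by unfold_locales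
  have "measure (\<Pi>\<^sub>M k\<in>UNIV. measure_pmf (P k)) (cylinder m w)
      = (\<Prod>k\<in>(\<lambda>i. m + int i) ` {..<length w}. measure (measure_pmf (P k)) {w ! nat (k - m)})"
    by (subst cylinder_eq_prod_emb[of "\<lambda>k. measure_pmf (P k)"]) (auto intro!: measure_PiM_emb)
  also have "\<dots> = (\<Prod>i<length w. pmf (P (m + int i)) (w ! i))"
    by (subst prod.reindex) (auto simp: inj_on_def measure_pmf_single)
  finally show ?thesis .
qed

abbreviation words :: "nat \<Rightarrow> bool list set" where
  "words n \<equiv> {u. length u = n}"

lemma finite_words: "finite (words n)"
  using finite_lists_length_eq[of "UNIV :: bool set" n] by simp

lemma sum_words_Suc: "(\<Sum>u\<in>words (Suc n). f u) = (\<Sum>x\<in>UNIV. \<Sum>u\<in>words n. f (x # u))"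
proof -
  have eq: "words (Suc n) = (\<lambda>(x, u). x # u) ` (UNIV \<times> words n)"
    by (auto simp: length_Suc_conv image_iff)
  show ?thesis
    unfolding eq by (subst sum.reindex) (auto simp: inj_on_def sum.cartesian_product case_prod_unfold)
qed

text \<open>
  The cylinders over the words of length \<open>n\<close> partition the configurations. Hence every function of
  \<open>n\<close> consecutive cells is a finite combination of indicators, and integrating it only requires
  the measures of cylinders.
\<close>

lemma sum_indicator_cylinders:
  fixes f :: "bool list \<Rightarrow> real"
  shows "(\<Sum>u\<in>words n. f u * indicator (cylinder m u) x) = f (map (\<lambda>i. x (m + int i)) [0..<n])"
proof -
  have "x \<in> cylinder m u \<longleftrightarrow> u = map (\<lambda>i. x (m + int i)) [0..<n]" if "u \<in> words n" for u
    using that by (auto simp: cylinder_def list_eq_iff_nth_eq)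
  then have "(\<Sum>u\<in>words n. f u * indicator (cylinder m u) x)
      = (\<Sum>u\<in>words n. if u = map (\<lambda>i. x (m + int i)) [0..<n] then f u else 0)"
    by (intro sum.cong) (auto simp: indicator_def)
  then show ?thesis
    by (simp add: finite_words)
qed

text \<open>
  This is the usual finite formula for the image of a measure under a PCA: a letter of the image
  depends on two neighbouring cells only, so conditioning on the word that sits above \<open>w\<close>, which has
  one letter more, makes the letters of \<open>w\<close> independent.
\<close>

lemma measure_pca_step_cylinder:
  "measure (pca_step \<theta> (bernoulli_product p)) (cylinder m w) =
    (\<Sum>u\<in>words (Suc (length w)). (\<Prod>i<Suc (length w). pmf (bernoulli_pmf p) (u ! i)) *
       (\<Prod>i<length w. pmf (bernoulli_pmf (\<theta> (u ! i) (u ! Suc i))) (w ! i)))"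
proof -
  let ?\<mu> = "bernoulli_product p"
  let ?f = "\<lambda>u. \<Prod>i<length w. pmf (bernoulli_pmf (\<theta> (u ! i) (u ! Suc i))) (w ! i)"
  interpret prob_space ?\<mu>
    unfolding bernoulli_product_def by (intro prob_space_PiM prob_space_measure_pmf)
  have sets: "sets ?\<mu> = sets config_space"
    unfolding bernoulli_product_def by (rule sets_PiM_pmf)
  have kernel: "measure (pca_kernel \<theta> x) (cylinder m w)
      = (\<Sum>u\<in>words (Suc (length w)). ?f u * indicator (cylinder m u) x)" for x
    unfolding sum_indicator_cylinders pca_kernel_def measure_PiM_cylinder
    by (intro prod.cong) (auto simp: nth_append algebra_simps simp del: upt_Suc)
  have "pca_kernel \<theta> \<in> measurable ?\<mu> (subprob_algebra config_space)"
    using measurable_prob_algebraD[OF measurable_pca_kernel[of \<theta>]] measurable_cong_sets[OF sets refl] by blast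
  then have "measure (pca_step \<theta> ?\<mu>) (cylinder m w) = (\<integral>x. measure (pca_kernel \<theta> x) (cylinder m w) \<partial>?\<mu>)"
    unfolding pca_step_def by (rule measure_bind) (rule cylinder_in_sets)
  also have "\<dots> = (\<Sum>u\<in>words (Suc (length w)). ?f u * measure ?\<mu> (cylinder m u))"
    unfolding kernel using cylinder_in_sets
    by (subst Bochner_Integration.integral_sum) (auto simp: sets emeasure_eq_measure)
  also have "\<dots> = (\<Sum>u\<in>words (Suc (length w)). (\<Prod>i<Suc (length w). pmf (bernoulli_pmf p) (u ! i)) * ?f u)"
    by (intro sum.cong) (auto simp: bernoulli_product_def measure_PiM_cylinder mult.commute)
  finally show ?thesis .
qed

context
  fixes \<theta> :: "bool \<Rightarrow> bool \<Rightarrow> real" and p :: real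
  assumes \<theta>: "\<And>x y. 0 \<le> \<theta> x y \<and> \<theta> x y \<le> 1" and p: "0 \<le> p" "p \<le> 1"
begin

lemma pmf_bernoulli_eq_trans_prob: "pmf (bernoulli_pmf (\<theta> x y)) \<alpha> = trans_prob \<theta> \<alpha> x y"
  using \<theta>[of x y] by (cases \<alpha>) (auto simp: trans_prob_def)

lemma trans_prob_nonneg: "0 \<le> trans_prob \<theta> \<alpha> x y"
  using \<theta>[of x y] by (auto simp: trans_prob_def)

lemma h_fun_bounds:
  assumes "0 \<le> q" "q \<le> 1"
  shows "0 \<le> h_fun \<theta> p \<alpha> q" and "h_fun \<theta> p \<alpha> q \<le> 1"
proof -
  have "0 \<le> (1 - q) * (1 - p) * trans_prob \<theta> \<alpha> False False" "0 \<le> (1 - q) * p * trans_prob \<theta> \<alpha> False True"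
    "0 \<le> q * (1 - p) * trans_prob \<theta> \<alpha> True False" "0 \<le> q * p * trans_prob \<theta> \<alpha> True True"
    using assms p trans_prob_nonneg by simp_all
  then show "0 \<le> h_fun \<theta> p \<alpha> q" "h_fun \<theta> p \<alpha> q \<le> 1"
    unfolding h_fun_def g_fun_def by (auto intro!: divide_nonneg_nonneg divide_le_eq_1_pos[THEN iffD2] simp: divide_le_eq)
qed

text \<open>
  Summing out the left cell leaves the joint law of the image letter and the right cell. The right-hand
  side disintegrates it along the letter: \<open>g_fun\<close> is the mass of \<open>\<alpha>\<close>, and \<open>h_fun\<close>, being
  the share of this mass with a 1 in the right cell, is the parameter of the conditional law.
\<close>

lemma bayes_rule_next_cell:
  assumes "0 \<le> q" "q \<le> 1"
  shows "(\<Sum>x\<in>UNIV. pmf (bernoulli_pmf q) x * pmf (bernoulli_pmf p) y * pmf (bernoulli_pmf (\<theta> x y)) \<alpha>)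
    = g_fun \<theta> p \<alpha> q * pmf (bernoulli_pmf (h_fun \<theta> p \<alpha> q)) y"
proof -
  let ?J = "\<lambda>y. (1 - q) * pmf (bernoulli_pmf p) y * trans_prob \<theta> \<alpha> False y
    + q * pmf (bernoulli_pmf p) y * trans_prob \<theta> \<alpha> True y"
  have J: "(\<Sum>x\<in>UNIV. pmf (bernoulli_pmf q) x * pmf (bernoulli_pmf p) y * pmf (bernoulli_pmf (\<theta> x y)) \<alpha>) = ?J y"
    using assms by (simp add: UNIV_bool pmf_bernoulli_eq_trans_prob)
  have nonneg: "0 \<le> ?J y" for y
    using assms trans_prob_nonneg by (intro add_nonneg_nonneg mult_nonneg_nonneg) auto
  have g: "g_fun \<theta> p \<alpha> q = ?J False + ?J True"
    using p by (simp add: g_fun_def)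
  have "h_fun \<theta> p \<alpha> q = ?J True / g_fun \<theta> p \<alpha> q"
    using p by (simp add: h_fun_def)
  \<comment> \<open>If \<open>g_fun\<close> vanishes, the two nonnegative joint probabilities vanish with it.\<close>
  then have gh: "g_fun \<theta> p \<alpha> q * h_fun \<theta> p \<alpha> q = ?J True"
    using nonneg[of True] nonneg[of False] g by (cases "g_fun \<theta> p \<alpha> q = 0") auto
  show ?thesis
    unfolding J using gh g h_fun_bounds[OF assms, of \<alpha>]
    by (cases y) (auto simp: right_diff_distrib)
qed

text \<open>
  The law \<open>q\<close> of the leftmost cell must be separate from that of the other cells and arbitrary in the
  induction, because summing out the leftmost cell changes the law of its neighbour to \<open>h_fun \<theta> p \<alpha> q\<close>.
\<close>

lemma sum_over_source_words:
  assumes "0 \<le> q" "q \<le> 1"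
  shows "(\<Sum>u\<in>words (Suc (length w)). pmf (bernoulli_pmf q) (u ! 0) *
      (\<Prod>i<length w. pmf (bernoulli_pmf p) (u ! Suc i)) *
      (\<Prod>i<length w. pmf (bernoulli_pmf (\<theta> (u ! i) (u ! Suc i))) (w ! i)))
    = (\<Prod>i<length w. g_fun \<theta> p (w ! i) (fold (h_fun \<theta> p) (take i w) q))"
  using assms
proof (induction w arbitrary: q)
  case Nil
  have "words (Suc 0) = {[False], [True]}"
    by (auto simp: length_Suc_conv)
  then show ?case
    using Nil by simp
next
  case (Cons a w)
  let ?n = "length w"
  let ?R = "\<lambda>u. (\<Prod>i<?n. pmf (bernoulli_pmf p) (u ! Suc i)) *
      (\<Prod>i<?n. pmf (bernoulli_pmf (\<theta> (u ! i) (u ! Suc i))) (w ! i))"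
  let ?h = "h_fun \<theta> p a q"
  have "(\<Sum>u\<in>words (Suc (length (a # w))). pmf (bernoulli_pmf q) (u ! 0) *
      (\<Prod>i<length (a # w). pmf (bernoulli_pmf p) (u ! Suc i)) *
      (\<Prod>i<length (a # w). pmf (bernoulli_pmf (\<theta> (u ! i) (u ! Suc i))) ((a # w) ! i)))
    = (\<Sum>x\<in>UNIV. \<Sum>u\<in>words (Suc ?n).
        pmf (bernoulli_pmf q) x * pmf (bernoulli_pmf p) (u ! 0) * pmf (bernoulli_pmf (\<theta> x (u ! 0))) a * ?R u)"
    unfolding sum_words_Suc[of _ "length (a # w)"]
    by (simp add: prod.lessThan_Suc_shift mult_ac del: prod.lessThan_Suc)
  also have "\<dots> = (\<Sum>u\<in>words (Suc ?n). (\<Sum>x\<in>UNIV.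
        pmf (bernoulli_pmf q) x * pmf (bernoulli_pmf p) (u ! 0) * pmf (bernoulli_pmf (\<theta> x (u ! 0))) a) * ?R u)"
    by (subst sum.swap) (simp only: sum_distrib_right)
  also have "\<dots> = g_fun \<theta> p a q * (\<Sum>u\<in>words (Suc ?n). pmf (bernoulli_pmf ?h) (u ! 0) * ?R u)"
    unfolding bayes_rule_next_cell[OF Cons.prems] by (simp add: sum_distrib_left mult_ac)
  also have "\<dots> = g_fun \<theta> p a q * (\<Prod>i<?n. g_fun \<theta> p (w ! i) (fold (h_fun \<theta> p) (take i w) ?h))"
    using Cons.IH[OF h_fun_bounds[OF Cons.prems]] by (simp add: mult.assoc)
  also have "\<dots> = (\<Prod>i<length (a # w). g_fun \<theta> p ((a # w) ! i) (fold (h_fun \<theta> p) (take i (a # w)) q))"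
    by (simp add: prod.lessThan_Suc_shift del: prod.lessThan_Suc)
  finally show ?case .
qed

end

theorem proposition3p1:
  fixes \<theta> :: "bool \<Rightarrow> bool \<Rightarrow> real" and p :: real and n :: nat and m :: int and w :: "bool list"
  assumes "\<And>x y. 0 \<le> \<theta> x y \<and> \<theta> x y \<le> 1"
    and "(\<theta> False False, \<theta> False True) \<notin> {(0, 0), (1, 1)}"
    and "(\<theta> True False, \<theta> True True) \<notin> {(0, 0), (1, 1)}"
    and "0 < p" and "p < 1"
    and "n \<ge> 1" and "length w = n"
  shows "measure (pca_step \<theta> (bernoulli_product p)) (cylinder m w) =
    g_fun \<theta> p (w ! 0) p * (\<Prod>i = 1..<n. g_fun \<theta> p (w ! i) (fold (h_fun \<theta> p) (take i w) p))"
proof -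
  have p: "0 \<le> p" "p \<le> 1"
    using assms(4,5) by simp_all
  have "measure (pca_step \<theta> (bernoulli_product p)) (cylinder m w)
      = (\<Prod>i<n. g_fun \<theta> p (w ! i) (fold (h_fun \<theta> p) (take i w) p))"
    unfolding measure_pca_step_cylinder prod.lessThan_Suc_shift
    using sum_over_source_words[OF assms(1) p p, of w] assms(7) by simp
  also have "\<dots> = g_fun \<theta> p (w ! 0) p * (\<Prod>i = 1..<n. g_fun \<theta> p (w ! i) (fold (h_fun \<theta> p) (take i w) p))"
    using assms(6) by (simp add: lessThan_atLeast0 prod.atLeast_Suc_lessThan)
  finally show ?thesis .
qed

end
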